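(* Let $0<c<1$, $\lambda>0$, $\beta=1$, and put $\eta = 1+\lambda\left(1-\frac1c\right)^2$. Let $\{S_n\}_{n\ge 0}$ be the sequence of polynomials orthogonal with respect to $$(f,g)_S=\sum_{k=0}^{+\infty} f(k)g(k)\,c^k+\lambda\sum_{k=0}^{+\infty}\Delta f(k)\,\Delta g(k)\,c^k ,$$ normalized by the condition that the leading coefficient of $S_n$ equals that of the Meixner polynomial $m_n(x;1,c)$, namely $\frac{1}{n!}\left(1-\frac1c\right)^n$. Let $\{q_n(\eta)\}_{n\ge0}$ be defined by $$q_{n+1}(\eta)=(1+\eta c)\,q_n(\eta)-c\,q_{n-1}(\eta)\quad (n\ge1),\qquad q_0(\eta)=q_1(\eta)=1 .$$ Set $$a=\frac{1+\eta c-\sqrt{(1+\eta c)^2-4c}}{2c},\qquad \gamma=\frac{a-a^2c}{1-a^2c},\qquad \delta=\frac{1-a}{1-a^2c}.$$ Then, for all $x$ and all $\omega$ with $|\omega|<ac<1$, $$\sum_{n=0}^{+\infty}q_n(\eta)\,S_n(x)\,\omega^n=\frac{1}{1-\omega}\left[\gamma\left(1-\frac{\omega}{ac}\right)^{x}\left(1-\frac{\omega}{a}\right)^{-x}+\delta\,(1-\omega a)^{x}(1-\omega c a)^{-x}\right].$$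
   Context: $\Delta$ is the forward difference operator, $\Delta f(k)=f(k+1)-f(k)$. The polynomials $S_n$ have degree exactly $n$ and satisfy $(S_n,S_m)_S=0$ for $n\ne m$. The variables $x$ and $\omega$ may be taken complex, and powers are principal branches (all bases have positive real part when $|\omega|<ac$). Here $\beta=1$ means that the weight $c^k(\beta)_k/k!$ of the general inner product reduces to $c^k$, where $(\beta)_0=1$, $(\beta)_k=\beta(\beta+1)\cdots(\beta+k-1)$. The Meixner polynomials are $m_n(x;\beta,c)=\sum_{k=0}^{n}\frac{(\beta+k)_{n-k}}{k!\,(n-k)!}(-x)_k\left(\frac1c-1\right)^k$. *)

theory Defs
  imports "HOL-Analysis.Analysis" "HOL-Computational_Algebra.Polynomial"
begin

definition fwd_diff :: "(real \<Rightarrow> real) \<Rightarrow> real \<Rightarrow> real" where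
  "fwd_diff f t = f (t + 1) - f t"

text \<open>
  Both series converge for polynomial \<open>f\<close>, \<open>g\<close> and \<open>0 < c < 1\<close>, the only case of interest;
  otherwise the value of a divergent \<^const>\<open>suminf\<close> is arbitrary.
\<close>

definition sobolev_ip :: "real \<Rightarrow> real \<Rightarrow> (real \<Rightarrow> real) \<Rightarrow> (real \<Rightarrow> real) \<Rightarrow> real" where
  "sobolev_ip c lam f g =
     (\<Sum>k. f (real k) * g (real k) * c ^ k)
       + lam * (\<Sum>k. fwd_diff f (real k) * fwd_diff g (real k) * c ^ k)"

text \<open>
  The factor \<open>(-x)\<^sub>k\<close> of the Meixner polynomial is the Pochhammer symbol of the polynomial
  \<open>-x = [:0, -1:]\<close>.
\<close>

definition meixner :: "real \<Rightarrow> real \<Rightarrow> nat \<Rightarrow> real poly" where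
  "meixner \<beta> c n =
     (\<Sum>k\<le>n. smult (pochhammer (\<beta> + real k) (n - k) / (fact k * fact (n - k)) * (1 / c - 1) ^ k)
                 (pochhammer [:0, -1:] k))"

fun q_seq :: "real \<Rightarrow> real \<Rightarrow> nat \<Rightarrow> real" where
  "q_seq c \<eta> 0 = 1"
| "q_seq c \<eta> (Suc 0) = 1"
| "q_seq c \<eta> (Suc (Suc n)) = (1 + \<eta> * c) * q_seq c \<eta> (Suc n) - c * q_seq c \<eta> n"

lemma pochhammer_minus_X:
  "degree (pochhammer [:0, -1::real:] k) = k" "lead_coeff (pochhammer [:0, -1::real:] k) = (-1) ^ k"
proof -
  have f: "[:0, -1::real:] + of_nat j = [:real j, -1:]" for j
    by (simp add: of_nat_poly)
  have "degree (pochhammer [:0, -1::real:] k) = k \<and> lead_coeff (pochhammer [:0, -1::real:] k) = (-1) ^ k"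
  proof (induction k)
    case (Suc k)
    then have "pochhammer [:0, -1::real:] k \<noteq> 0"
      by (metis leading_coeff_0_iff power_not_zero neg_equal_0_iff_equal zero_neq_one)
    then have "degree (pochhammer [:0, -1::real:] k * [:real k, -1:])
        = degree (pochhammer [:0, -1::real:] k) + degree [:real k, -1:]"
      by (intro degree_mult_eq) auto
    moreover have "lead_coeff (pochhammer [:0, -1::real:] k * [:real k, -1:])
        = lead_coeff (pochhammer [:0, -1::real:] k) * lead_coeff [:real k, -1:]"
      by (rule lead_coeff_mult)
    ultimately show ?case
      using Suc.IH[THEN conjunct1] Suc.IH[THEN conjunct2, unfolded Suc.IH[THEN conjunct1]]
      by (simp add: pochhammer_Suc f del: mult_pCons_right)
  qed simp
  then show "degree (pochhammer [:0, -1::real:] k) = k"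
    "lead_coeff (pochhammer [:0, -1::real:] k) = (-1) ^ k" by auto
qed

lemma lead_coeff_meixner:
  assumes "0 < c" "c < 1"
  shows "degree (meixner \<beta> c n) = n" "lead_coeff (meixner \<beta> c n) = 1 / fact n * (1 - 1 / c) ^ n"
proof -
  have "coeff (meixner \<beta> c n) n
      = (\<Sum>k\<le>n. pochhammer (\<beta> + real k) (n - k) / (fact k * fact (n - k)) * (1 / c - 1) ^ k
                 * coeff (pochhammer [:0, -1:] k) n)"
    by (simp add: meixner_def coeff_sum)
  also have "\<dots> = (\<Sum>k\<in>{n}. pochhammer (\<beta> + real k) (n - k) / (fact k * fact (n - k)) * (1 / c - 1) ^ k
                 * coeff (pochhammer [:0, -1:] k) n)"
    by (rule sum.mono_neutral_right) (auto intro!: coeff_eq_0 simp: pochhammer_minus_X(1))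
  also have "\<dots> = 1 / fact n * (1 / c - 1) ^ n * (- 1) ^ n"
    using pochhammer_minus_X[of n] by simp
  also have "\<dots> = 1 / fact n * (1 - 1 / c) ^ n"
    by (simp add: power_mult_distrib [symmetric])
  finally have c: "coeff (meixner \<beta> c n) n = 1 / fact n * (1 - 1 / c) ^ n" .
  have "degree (meixner \<beta> c n) \<le> n"
    unfolding meixner_def
    by (intro degree_sum_le order.trans[OF degree_smult_le]) (auto simp: pochhammer_minus_X(1))
  moreover have "coeff (meixner \<beta> c n) n \<noteq> 0"
    using assms by (simp add: c field_simps)
  ultimately show d: "degree (meixner \<beta> c n) = n"
    by (simp add: le_degree order.antisym)
  show "lead_coeff (meixner \<beta> c n) = 1 / fact n * (1 - 1 / c) ^ n"
    by (simp only: d c)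
qed

end

theory Submission imports Defs begin

text \<open>
  Put \<open>t = 1 - 1 / c\<close>, \<open>m\<^sub>n = m\<^sub>n(\<cdot>;1,c)\<close>, \<open>p\<^sub>0 = 1\<close> and \<open>p\<^sub>n = m\<^sub>n - m\<^sub>n\<^sub>-\<^sub>1\<close>.  Since \<open>\<Delta> p\<^sub>n = t m\<^sub>n\<^sub>-\<^sub>1\<close> and the \<open>m\<^sub>n\<close> are
  orthogonal with \<open>\<langle>m\<^sub>n, m\<^sub>n\<rangle>\<close> proportional to \<open>c\<^sup>-\<^sup>n\<close>, the Gram matrix of the \<open>p\<^sub>n\<close> for the
  Sobolev inner product is tridiagonal, and the recurrence of \<open>q\<^sub>n\<close> says exactly that
  \<open>\<Sum>j\<le>n. q\<^sub>j p\<^sub>j\<close> is orthogonal to all polynomials of degree less than \<open>n\<close>; hence it equals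
  \<open>q\<^sub>n S\<^sub>n\<close>.  Summing over \<open>n\<close> gives the factor \<open>1 / (1 - \<omega>)\<close> times \<open>\<Sum>j. q\<^sub>j p\<^sub>j(x) \<omega>\<^sup>j\<close>, and the
  latter splits by \<open>q\<^sub>j = \<gamma> a\<^sup>-\<^sup>j + \<delta> (c a)\<^sup>j\<close> into two instances of
  \<open>\<Sum>j. p\<^sub>j(x) z\<^sup>j = ((1 - z / c) / (1 - z))\<^sup>x\<close>.
\<close>

section \<open>Power series with binomial and polynomial coefficients\<close>

text \<open>Induction on \<open>k\<close>: the Cauchy product with the geometric series raises both
  binomial indices by the hockey-stick identity. Absolute convergence is carried along because the
  Cauchy product requires it.\<close>

lemma binomial_series:
  fixes z :: "'a :: {real_normed_field, banach}"
  assumes z: "norm z < 1"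
  shows "(\<lambda>n. of_nat (n choose k) * z ^ n) sums (z ^ k / (1 - z) ^ Suc k)"
    and "summable (\<lambda>n. norm (of_nat (n choose k) * z ^ n))"
proof -
  let ?b = "\<lambda>k n. of_nat (n choose k) * z ^ n"
  have geo: "summable (\<lambda>n. norm (z ^ n))"
    using z by (simp add: norm_power)
  \<comment> \<open>Kept generic in the type of \<open>w\<close>, since it serves both for
    \<open>z\<close> and for \<open>norm z\<close>.\<close>
  have conv: "(\<Sum>i\<le>n. of_nat (i choose k) * w ^ i * w ^ (n - i)) = of_nat (Suc n choose Suc k) * w ^ n"
    for k n and w :: "'b :: comm_semiring_1"
  proof -
    have "(\<Sum>i\<le>n. of_nat (i choose k) * w ^ i * w ^ (n - i)) = (\<Sum>i\<le>n. of_nat (i choose k) * w ^ n)"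
      by (rule sum.cong) (auto simp: mult.assoc simp flip: power_add)
    then show ?thesis
      by (simp only: sum_choose_upper flip: sum_distrib_right of_nat_sum)
  qed
  have "?b k sums (z ^ k / (1 - z) ^ Suc k) \<and> summable (\<lambda>n. norm (?b k n))"
  proof (induction k)
    case 0
    then show ?case
      using geometric_sums[OF z] geo by simp
  next
    case (Suc k)
    have *: "(\<lambda>n. of_nat (Suc n choose Suc k) * z ^ n) sums (z ^ k / (1 - z) ^ Suc k * (1 / (1 - z)))"
      using Cauchy_product_sums[OF conjunct2[OF Suc.IH] geo] Suc.IH geometric_sums[OF z]
      by (simp only: conv sums_unique[symmetric])
        (simp add: sums_iff)
    have "(\<lambda>n. z * (of_nat (Suc n choose Suc k) * z ^ n)) sums (z * (z ^ k / (1 - z) ^ Suc k * (1 / (1 - z))))"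
      by (rule sums_mult[OF *])
    then have "(\<lambda>n. ?b (Suc k) (Suc n)) sums (z ^ Suc k / (1 - z) ^ Suc (Suc k))"
      by (simp add: mult_ac del: binomial_Suc_Suc)
    then have 1: "?b (Suc k) sums (z ^ Suc k / (1 - z) ^ Suc (Suc k))"
      by (subst (asm) sums_Suc_iff) simp
    have "summable (\<lambda>n. \<Sum>i\<le>n. norm (?b k i) * norm (z ^ (n - i)))"
      by (rule summable_Cauchy_product) (use Suc.IH geo in auto)
    then have "summable (\<lambda>n. of_nat (Suc n choose Suc k) * norm z ^ n)"
      by (simp only: norm_mult norm_power norm_of_nat conv)
    from summable_mult[OF this, of "norm z"]
    have "summable (\<lambda>n. norm (?b (Suc k) (Suc n)))"
      by (simp add: norm_mult norm_power mult_ac del: binomial_Suc_Suc of_nat_Suc)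
    then have "summable (\<lambda>n. norm (?b (Suc k) n))"
      by (subst (asm) summable_Suc_iff)
    with 1 show ?case by blast
  qed
  then show "?b k sums (z ^ k / (1 - z) ^ Suc k)" "summable (\<lambda>n. norm (?b k n))"
    by auto
qed

text \<open>Termwise differentiation preserves convergence inside the unit disc; multiplying by
  \<open>c\<close> afterwards restores the exponent and adds one factor \<open>j\<close>.\<close>

lemma summable_power_mult_power:
  fixes c :: real
  assumes "\<bar>c\<bar> < 1"
  shows "summable (\<lambda>j. real j ^ k * c ^ j)"
  using assms
proof (induction k arbitrary: c)
  case (Suc k)
  have "summable (\<lambda>n. diffs (\<lambda>n. real n ^ k) n * c ^ n)"
    by (rule termdiff_converges[where K = 1]) (use Suc in auto)
  from summable_mult[OF this, of c] have "summable (\<lambda>n. real (Suc n) ^ Suc k * c ^ Suc n)"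
    by (simp add: diffs_def mult_ac del: of_nat_Suc)
  then show ?case
    by (subst (asm) summable_Suc_iff)
qed (simp add: summable_geometric)

lemma summable_poly_power:
  fixes c :: real
  assumes "\<bar>c\<bar> < 1"
  shows "summable (\<lambda>j. poly p (real j) * c ^ j)"
proof -
  have "summable (\<lambda>j. \<Sum>i\<le>degree p. coeff p i * (real j ^ i * c ^ j))"
    by (intro summable_sum summable_mult summable_power_mult_power assms)
  then show ?thesis
    by (simp add: poly_altdef sum_distrib_right mult.assoc)
qed

section \<open>Evaluating real polynomials at points of a real algebra\<close>

lemma poly_of_real_add:
  "poly (map_poly of_real (p + q)) (x :: 'a :: {real_algebra_1, comm_ring_1}) =
     poly (map_poly of_real p) x + poly (map_poly of_real q) x"
proof -
  have "map_poly of_real (p + q) = map_poly of_real p + (map_poly of_real q :: 'a poly)"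
    by (rule poly_eqI) (simp add: coeff_map_poly)
  then show ?thesis by simp
qed

lemma poly_of_real_smult:
  "poly (map_poly of_real (smult b p)) (x :: 'a :: {real_algebra_1, comm_ring_1}) =
     of_real b * poly (map_poly of_real p) x"
proof -
  have "map_poly of_real (smult b p) = smult (of_real b) (map_poly of_real p :: 'a poly)"
    by (rule poly_eqI) (simp add: coeff_map_poly)
  then show ?thesis by simp
qed

lemma poly_of_real_sum:
  "poly (map_poly of_real (\<Sum>i\<in>A. f i)) (x :: 'a :: {real_algebra_1, comm_ring_1}) =
     (\<Sum>i\<in>A. poly (map_poly of_real (f i)) x)"
  by (induction A rule: infinite_finite_induct) (simp_all add: poly_of_real_add)

lemma poly_of_real_mult:
  "poly (map_poly of_real (p * q)) (x :: 'a :: {real_algebra_1, comm_ring_1}) =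
     poly (map_poly of_real p) x * poly (map_poly of_real q) x"
  by (induction p rule: pCons_induct)
    (simp_all add: poly_of_real_add poly_of_real_smult map_poly_pCons algebra_simps)

lemma poly_of_real_pochhammer:
  "poly (map_poly of_real (pochhammer [:0, -1:] k)) (x :: 'a :: {real_algebra_1, comm_ring_1}) =
     pochhammer (- x) k"
proof (induction k)
  case (Suc k)
  have "[:0, -1::real:] + of_nat k = [:real k, -1:]"
    by (simp add: of_nat_poly)
  then show ?case
    by (simp add: pochhammer_Suc poly_of_real_mult Suc map_poly_pCons del: mult_pCons_right)
qed (simp add: one_pCons map_poly_pCons)

section \<open>Meixner polynomials for \<open>\<beta> = 1\<close> and their consecutive
  differences\<close>

text \<open>For \<open>\<beta> = 1\<close> the Pochhammer quotient collapses to a binomial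
  coefficient over \<open>fact k\<close>, and the sign in \<open>pochhammer (- x) k\<close> turns
  \<open>1 / c - 1\<close> into \<open>1 - 1 / c\<close>. Orthogonality uses real \<open>x\<close>,
  the generating function complex \<open>x\<close>.\<close>

lemma poly_meixner_one:
  fixes x :: "'a :: {real_normed_field, field_char_0}"
  shows "poly (map_poly of_real (meixner 1 c n)) x =
    (\<Sum>k\<le>n. of_nat (n choose k) * (x gchoose k) * of_real (1 - 1 / c) ^ k)"
proof -
  have "of_real (pochhammer (1 + real k) (n - k) / (fact k * fact (n - k)) * (1 / c - 1) ^ k) *
          pochhammer (- x) k =
        of_nat (n choose k) * (x gchoose k) * of_real (1 - 1 / c) ^ k" if "k \<le> n" for k
  proof -
    have "pochhammer (1 + real k) (n - k) = fact n / fact k"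
      using pochhammer_product[OF that, of "1::real"] by (simp add: pochhammer_fact[symmetric])
    then have "of_real (pochhammer (1 + real k) (n - k) / (fact k * fact (n - k)) * (1 / c - 1) ^ k) =
         (of_nat (n choose k) * (of_real (1 / c - 1) ^ k) / fact k :: 'a)"
      using that by (simp add: binomial_fact of_real_fact)
    moreover have "(of_real (1 - 1 / c) :: 'a) ^ k = (-1) ^ k * of_real (1 / c - 1) ^ k"
      by (simp flip: power_mult_distrib)
    ultimately show ?thesis
      by (simp add: gbinomial_pochhammer mult_ac flip: power_add)
  qed
  then show ?thesis
    by (simp add: meixner_def poly_of_real_sum poly_of_real_smult poly_of_real_pochhammer
        del: of_real_mult of_real_divide of_real_power)
qed

text \<open>The \<open>p\<^sub>n\<close> of the overview; the value at 0 follows the convention that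
  the polynomial of index -1 is zero.\<close>

definition meixner_diff :: "real \<Rightarrow> nat \<Rightarrow> real poly" where
  "meixner_diff c n = (case n of 0 \<Rightarrow> 1 | Suc k \<Rightarrow> meixner 1 c (Suc k) - meixner 1 c k)"

lemma meixner_0 [simp]: "meixner \<beta> c 0 = 1"
  by (simp add: meixner_def one_pCons)

lemma meixner_diff_0 [simp]: "meixner_diff c 0 = 1"
  by (simp add: meixner_diff_def)

lemma meixner_diff_Suc: "meixner_diff c (Suc n) = meixner 1 c (Suc n) - meixner 1 c n"
  by (simp add: meixner_diff_def)

lemma poly_meixner_diff_Suc:
  fixes x :: "'a :: {real_normed_field, field_char_0}"
  shows "poly (map_poly of_real (meixner_diff c (Suc n))) x =
    (\<Sum>k\<le>n. of_nat (n choose k) * (x gchoose Suc k) * of_real (1 - 1 / c) ^ Suc k)"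
proof -
  let ?g = "\<lambda>k. (x gchoose k) * of_real (1 - 1 / c) ^ k"
  have m: "poly (map_poly of_real (meixner 1 c n)) x = (\<Sum>k\<le>n. of_nat (n choose k) * ?g k)" for n
    by (simp only: poly_meixner_one mult.assoc)
  have "poly (map_poly of_real (meixner_diff c (Suc n))) x =
      poly (map_poly of_real (meixner 1 c (Suc n))) x - poly (map_poly of_real (meixner 1 c n)) x"
    using poly_of_real_add[of "meixner_diff c (Suc n)" "meixner 1 c n" x]
    by (simp add: meixner_diff_Suc)
  \<comment> \<open>The added term vanishes because \<open>n choose Suc n = 0\<close>; with equal
    ranges, Pascal's rule applies termwise.\<close>
  also have "poly (map_poly of_real (meixner 1 c n)) x = (\<Sum>k\<le>Suc n. of_nat (n choose k) * ?g k)"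
    by (simp add: m)
  also have "poly (map_poly of_real (meixner 1 c (Suc n))) x - \<dots> =
      (\<Sum>k\<le>Suc n. (of_nat (Suc n choose k) - of_nat (n choose k)) * ?g k)"
    by (simp only: m sum_subtractf left_diff_distrib)
  also have "\<dots> = (\<Sum>k\<le>n. of_nat (n choose k) * ?g (Suc k))"
    by (subst sum.atMost_Suc_shift) (simp add: algebra_simps)
  finally show ?thesis
    by (simp only: mult.assoc)
qed

lemma poly_meixner_diff_Suc_real:
  "poly (meixner_diff c (Suc n)) x =
    (\<Sum>k\<le>n. of_nat (n choose k) * (x gchoose Suc k) * (1 - 1 / c) ^ Suc k)"
  using poly_meixner_diff_Suc[of c n x] by (simp add: map_poly_idI')

lemma poly_meixner_one_real:
  "poly (meixner 1 c n) x = (\<Sum>k\<le>n. of_nat (n choose k) * (x gchoose k) * (1 - 1 / c) ^ k)"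
  using poly_meixner_one[of c n x] by (simp add: map_poly_idI')

text \<open>Pascal's rule in the upper argument, \<open>x + 1\<close>, of the generalized binomial
  coefficient.\<close>

lemma meixner_diff_shift:
  "meixner_diff c (Suc n) \<circ>\<^sub>p [:1, 1:] = meixner_diff c (Suc n) + smult (1 - 1 / c) (meixner 1 c n)"
proof (intro poly_eq_poly_eq_iff[THEN iffD1] ext)
  fix x :: real
  define t where "t = 1 - 1 / c"
  show "poly (meixner_diff c (Suc n) \<circ>\<^sub>p [:1, 1:]) x =
      poly (meixner_diff c (Suc n) + smult (1 - 1 / c) (meixner 1 c n)) x"
    unfolding poly_add poly_smult poly_pcompose poly_meixner_diff_Suc_real poly_meixner_one_real t_def[symmetric]
    by (simp add: add.commute[of 1] gbinomial_Suc_Suc distrib_left distrib_right sum.distrib sum_distrib_left mult_ac)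
qed

lemma poly_meixner_diff_Suc_0 [simp]: "poly (meixner_diff c (Suc n)) 0 = 0"
  by (simp add: poly_meixner_diff_Suc_real)

section \<open>Orthogonality of the Meixner polynomials for the weight \<open>c ^ k\<close>\<close>

definition geom_sum :: "real \<Rightarrow> real poly \<Rightarrow> real" where
  "geom_sum c p = (\<Sum>j. poly p (real j) * c ^ j)"

context
  fixes c :: real
  assumes c: "0 < c" "c < 1"
begin

lemma geom_sums: "(\<lambda>j. poly p (real j) * c ^ j) sums geom_sum c p"
  unfolding geom_sum_def using c by (intro summable_sums summable_poly_power) auto

lemma geom_sum_add: "geom_sum c (p + q) = geom_sum c p + geom_sum c q"
  using sums_add[OF geom_sums[of p] geom_sums[of q]] geom_sums[of "p + q"]
  by (simp add: sums_iff algebra_simps)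

lemma geom_sum_smult: "geom_sum c (smult b p) = b * geom_sum c p"
  using sums_mult[OF geom_sums[of p], of b] geom_sums[of "smult b p"]
  by (simp add: sums_iff algebra_simps)

lemma geom_sum_diff: "geom_sum c (p - q) = geom_sum c p - geom_sum c q"
  using geom_sum_add[of "p - q" q] by simp

lemma geom_sum_shift: "geom_sum c p = poly p 0 + c * geom_sum c (p \<circ>\<^sub>p [:1, 1:])"
proof -
  have "(\<lambda>j. c * (poly (p \<circ>\<^sub>p [:1, 1:]) (real j) * c ^ j)) sums (c * geom_sum c (p \<circ>\<^sub>p [:1, 1:]))"
    by (intro sums_mult geom_sums)
  then have "(\<lambda>j. poly p (real (Suc j)) * c ^ Suc j) sums (c * geom_sum c (p \<circ>\<^sub>p [:1, 1:]))"
    by (simp add: poly_pcompose mult_ac)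
  then have "(\<lambda>j. poly p (real j) * c ^ j) sums (c * geom_sum c (p \<circ>\<^sub>p [:1, 1:]) + poly p 0)"
    by (subst (asm) sums_Suc_iff) simp
  with geom_sums[of p] show ?thesis
    using sums_unique2 by fastforce
qed

text \<open>All terms are nonnegative, so \<open>p\<close> vanishes at every natural number and has
  infinitely many roots.\<close>

lemma geom_sum_square_eq_0_imp:
  assumes "geom_sum c (p * p) = 0"
  shows "p = 0"
proof (rule ccontr)
  assume "p \<noteq> 0"
  have "(\<lambda>j. poly p (real j) * poly p (real j) * c ^ j) sums 0"
    using geom_sums[of "p * p"] assms by simp
  then have "poly p (real j) * poly p (real j) * c ^ j = 0" for j
    using suminf_eq_zero_iff[of "\<lambda>j. poly p (real j) * poly p (real j) * c ^ j"] c
    by (auto simp: sums_iff)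
  then have "range real \<subseteq> {x. poly p x = 0}"
    using c by auto
  moreover have "infinite (range real)"
    using inj_of_nat range_inj_infinite by blast
  ultimately show False
    using poly_roots_finite[OF \<open>p \<noteq> 0\<close>] finite_subset by blast
qed

text \<open>Shifting the series of \<open>meixner_diff c (Suc n)\<close> leaves no boundary term,
  and the contributions of \<open>meixner 1 c n\<close> cancel since
  \<open>c * (1 - 1 / c) = c - 1\<close>.\<close>

lemma geom_sum_meixner_Suc: "geom_sum c (meixner 1 c (Suc n)) = 0"
proof -
  have "geom_sum c (meixner_diff c (Suc n)) =
      c * (geom_sum c (meixner_diff c (Suc n)) + (1 - 1 / c) * geom_sum c (meixner 1 c n))"
    by (subst geom_sum_shift) (simp add: meixner_diff_shift geom_sum_add geom_sum_smult)
  then have "(1 - c) * geom_sum c (meixner 1 c (Suc n)) = 0"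
    using c by (simp add: meixner_diff_Suc geom_sum_diff field_simps)
  then show ?thesis using c by simp
qed

text \<open>
  For \<open>F = p\<^sub>n\<^sub>+\<^sub>1 p\<^sub>m\<^sub>+\<^sub>1\<close> one has \<open>F(x) - c F(x + 1) = (1 - c) (m\<^sub>n\<^sub>+\<^sub>1 m\<^sub>m\<^sub>+\<^sub>1 - m\<^sub>n m\<^sub>m / c)\<close>, and the series
  of the left-hand side telescopes to \<open>F(0) = 0\<close>.
\<close>

lemma geom_sum_meixner_mult_Suc:
  "c * geom_sum c (meixner 1 c (Suc n) * meixner 1 c (Suc m)) = geom_sum c (meixner 1 c n * meixner 1 c m)"
proof -
  let ?m = "meixner 1 c" and ?p = "meixner_diff c"
  define G where "G i j = geom_sum c (?m i * ?m j)" for i j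
  have pp: "geom_sum c (?p (Suc n) * ?p (Suc m)) = G (Suc n) (Suc m) - G (Suc n) m - G n (Suc m) + G n m"
    by (simp add: meixner_diff_Suc algebra_simps geom_sum_add geom_sum_diff G_def)
  have shift: "?p (Suc k) \<circ>\<^sub>p [:1, 1:] = ?m (Suc k) - smult (1 / c) (?m k)" for k
    using meixner_diff_shift[of c k] by (simp add: meixner_diff_Suc smult_diff_left)
  have "geom_sum c ((?p (Suc n) * ?p (Suc m)) \<circ>\<^sub>p [:1, 1:]) =
      G (Suc n) (Suc m) - 1 / c * G (Suc n) m - 1 / c * G n (Suc m) + 1 / c * (1 / c) * G n m"
    by (simp add: pcompose_mult shift algebra_simps geom_sum_add geom_sum_diff geom_sum_smult G_def)
  with geom_sum_shift[of "?p (Suc n) * ?p (Suc m)"]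
  have "G (Suc n) (Suc m) - G (Suc n) m - G n (Suc m) + G n m =
      c * (G (Suc n) (Suc m) - 1 / c * G (Suc n) m - 1 / c * G n (Suc m) + 1 / c * (1 / c) * G n m)"
    by (simp add: pp)
  \<comment> \<open>The mixed terms get coefficient -1, as on the left-hand side, and drop
    out.\<close>
  also have "\<dots> = c * G (Suc n) (Suc m) - G (Suc n) m - G n (Suc m) + G n m / c"
    using c by (simp add: field_simps)
  finally have "(1 - c) * (c * G (Suc n) (Suc m) - G n m) = 0"
    using c by (simp add: field_simps)
  with c show ?thesis by (simp add: G_def)
qed

text \<open>Both indices are lowered together, at the cost of a factor \<open>1 / c\<close>, until
  one of them is 0.\<close>

lemma geom_sum_meixner_mult:
  "geom_sum c (meixner 1 c n * meixner 1 c m) = (if n = m then geom_sum c 1 / c ^ n else 0)"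
proof (induction n arbitrary: m)
  case 0
  then show ?case by (cases m) (simp_all add: geom_sum_meixner_Suc)
next
  case (Suc n)
  show ?case
  proof (cases m)
    case (Suc k)
    with Suc.IH[of k] geom_sum_meixner_mult_Suc[of n k] c show ?thesis
      by (auto simp: field_simps)
  qed (simp add: geom_sum_meixner_Suc)
qed

end

section \<open>The Sobolev inner product and its tridiagonal Gram matrix\<close>

definition fwd_diff_poly :: "real poly \<Rightarrow> real poly" where
  "fwd_diff_poly p = p \<circ>\<^sub>p [:1, 1:] - p"

definition sobolev :: "real \<Rightarrow> real \<Rightarrow> real poly \<Rightarrow> real poly \<Rightarrow> real" where
  "sobolev c lam p q = geom_sum c (p * q) + lam * geom_sum c (fwd_diff_poly p * fwd_diff_poly q)"

lemma sobolev_ip_poly: "sobolev_ip c lam (poly p) (poly q) = sobolev c lam p q"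
  by (simp add: sobolev_ip_def sobolev_def geom_sum_def fwd_diff_def fwd_diff_poly_def poly_pcompose add.commute)

lemma fwd_diff_poly_add: "fwd_diff_poly (p + q) = fwd_diff_poly p + fwd_diff_poly q"
  by (simp add: fwd_diff_poly_def pcompose_add)

lemma fwd_diff_poly_smult: "fwd_diff_poly (smult b p) = smult b (fwd_diff_poly p)"
  by (simp add: fwd_diff_poly_def pcompose_smult smult_diff_right)

lemma fwd_diff_poly_meixner_diff:
  "fwd_diff_poly (meixner_diff c (Suc n)) = smult (1 - 1 / c) (meixner 1 c n)"
  "fwd_diff_poly (meixner_diff c 0) = 0"
  by (simp_all add: fwd_diff_poly_def meixner_diff_shift pcompose_1)

lemma sobolev_commute: "sobolev c lam p q = sobolev c lam q p"
  by (simp add: sobolev_def mult.commute)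

context
  fixes c lam :: real
  assumes c: "0 < c" "c < 1"
begin

lemma sobolev_add_left: "sobolev c lam (p + q) r = sobolev c lam p r + sobolev c lam q r"
  using c by (simp add: sobolev_def fwd_diff_poly_add geom_sum_add algebra_simps)

lemma sobolev_smult_left: "sobolev c lam (smult b p) q = b * sobolev c lam p q"
  using c by (simp add: sobolev_def fwd_diff_poly_smult geom_sum_smult algebra_simps)

lemma sobolev_add_right: "sobolev c lam r (p + q) = sobolev c lam r p + sobolev c lam r q"
  by (metis sobolev_commute sobolev_add_left)

lemma sobolev_smult_right: "sobolev c lam q (smult b p) = b * sobolev c lam q p"
  by (metis sobolev_commute sobolev_smult_left)

lemma sobolev_self_eq_0_imp:
  assumes "lam > 0" "sobolev c lam p p = 0"
  shows "p = 0"
proof -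
  have nn: "geom_sum c (q * q) \<ge> 0" for q
    by (rule sums_le[OF _ sums_zero geom_sums[OF c]]) (use c in auto)
  have "geom_sum c (p * p) = 0"
    using assms nn[of p] mult_nonneg_nonneg[of lam, OF _ nn[of "fwd_diff_poly p"]]
    unfolding sobolev_def by linarith
  then show ?thesis
    by (rule geom_sum_square_eq_0_imp[OF c])
qed

text \<open>Expanding into products of Meixner polynomials, the lower-index product occurs once in
  the plain part and \<open>lam * (1 - 1 / c)\<^sup>2\<close> times in the difference part, together
  \<open>eta\<close> times.\<close>

lemma sobolev_meixner_diff:
  assumes eta: "eta = 1 + lam * (1 - 1 / c)\<^sup>2"
  shows "sobolev c lam (meixner_diff c n) (meixner_diff c m) =
    (if n = m then if n = 0 then geom_sum c 1 else geom_sum c 1 / c ^ n * (1 + eta * c)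
     else if n = Suc m then - geom_sum c 1 / c ^ m
     else if m = Suc n then - geom_sum c 1 / c ^ n
     else 0)"
proof -
  have s: "geom_sum c (meixner 1 c k) = (if k = 0 then geom_sum c 1 else 0)" for k
    using geom_sum_meixner_mult[OF c, of k 0] by simp
  have e: "sobolev c lam (meixner_diff c (Suc i)) (meixner_diff c (Suc j)) =
      geom_sum c (meixner 1 c (Suc i) * meixner 1 c (Suc j)) - geom_sum c (meixner 1 c (Suc i) * meixner 1 c j)
      - geom_sum c (meixner 1 c i * meixner 1 c (Suc j)) + eta * geom_sum c (meixner 1 c i * meixner 1 c j)" for i j
    unfolding sobolev_def fwd_diff_poly_meixner_diff
    using c by (simp add: meixner_diff_Suc algebra_simps geom_sum_add geom_sum_diff geom_sum_smult eta
      power2_eq_square)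
  \<comment> \<open>Row 0 has no difference part; its different diagonal entry matches the initial
    values \<open>q\<^sub>0 = q\<^sub>1\<close>.\<close>
  have 0: "sobolev c lam (meixner_diff c 0) (meixner_diff c j) = geom_sum c (meixner_diff c j)" for j
    unfolding sobolev_def fwd_diff_poly_meixner_diff by (simp add: geom_sum_def)
  have d: "geom_sum c (meixner_diff c j) =
      (if j = 0 then geom_sum c 1 else if j = 1 then - geom_sum c 1 else 0)" for j
    using c by (cases j) (auto simp: meixner_diff_Suc geom_sum_diff s)
  show ?thesis
  proof (cases "n = 0 \<or> m = 0")
    case True
    then show ?thesis
      using 0[unfolded meixner_diff_0]
        0[of n, unfolded sobolev_commute[of c lam "meixner_diff c 0" "meixner_diff c n"]]
      by (auto simp: d)
  next
    case False
    then obtain i j where "n = Suc i" "m = Suc j"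
      by (meson not0_implies_Suc)
    then show ?thesis
      using c by (auto simp: e geom_sum_meixner_mult field_simps)
  qed
qed

end

section \<open>Identification of the Sobolev orthogonal polynomials\<close>

text \<open>The \<open>B m\<close> with \<open>m < n\<close> span the polynomials of degree below
  \<open>n\<close>; the induction strips leading terms. \<open>B 0\<close> must be nonzero
  explicitly because the zero polynomial also has degree 0.\<close>

lemma linear_functional_vanishes:
  fixes L :: "'a :: field poly \<Rightarrow> 'a"
  assumes add: "\<And>p q. L (p + q) = L p + L q" and smult: "\<And>b p. L (smult b p) = b * L p"
    and deg: "\<And>m. degree (B m) = m" and nz: "B 0 \<noteq> 0"
    and B: "\<And>m. m < n \<Longrightarrow> L (B m) = 0"
    and p: "p = 0 \<or> degree p < n"
  shows "L p = 0"
proof -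
  have B_nz: "B m \<noteq> 0" for m
    using nz deg[of m] by (cases "m = 0") (metis degree_0)+
  have L0: "L 0 = 0"
    using smult[of 0 0] by simp
  have "L p = 0" if "degree p < n" for p
    using that
  proof (induction "degree p" arbitrary: p rule: less_induct)
    case less
    define b where "b = lead_coeff p / lead_coeff (B (degree p))"
    define r where "r = p - smult b (B (degree p))"
    have "coeff r (degree p) = 0"
      using leading_coeff_neq_0[OF B_nz[of "degree p"]] by (simp add: r_def b_def deg)
    moreover have "degree r \<le> degree p"
      unfolding r_def by (intro degree_diff_le order.trans[OF degree_smult_le]) (simp_all add: deg)
    ultimately have "r = 0 \<or> degree r < degree p"
      by (metis leading_coeff_0_iff le_neq_implies_less)
    then have "L r = 0"
      using less L0 by auto
    moreover have "p = r + smult b (B (degree p))"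
      by (simp add: r_def)
    ultimately show "L p = 0"
      using add[of r "smult b (B (degree p))"] smult[of b "B (degree p)"] B[OF less.prems] by simp
  qed
  with p L0 show ?thesis by blast
qed

lemma degree_meixner_diff:
  assumes "0 < c" "c < 1"
  shows "degree (meixner_diff c n) = n" "lead_coeff (meixner_diff c n) = lead_coeff (meixner 1 c n)"
proof -
  have "coeff (meixner_diff c n) n = lead_coeff (meixner 1 c n)" "degree (meixner_diff c n) \<le> n"
    using lead_coeff_meixner(1)[OF assms, of 1]
    by (cases n; auto simp: meixner_diff_Suc coeff_eq_0 intro!: degree_diff_le)+
  moreover have "lead_coeff (meixner 1 c n) \<noteq> 0"
    unfolding lead_coeff_meixner(2)[OF assms] using assms by simp
  ultimately show "degree (meixner_diff c n) = n" "lead_coeff (meixner_diff c n) = lead_coeff (meixner 1 c n)"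
    by (metis le_antisym le_degree)+
qed

lemma sobolev_sum_left:
  assumes "0 < c" "c < 1"
  shows "sobolev c lam (\<Sum>i\<in>A. f i) p = (\<Sum>i\<in>A. sobolev c lam (f i) p)"
  by (induction A rule: infinite_finite_induct)
    (use sobolev_smult_left[OF assms, of lam 0 0] in \<open>simp_all add: sobolev_add_left[OF assms]\<close>)

lemma sobolev_q_sum_meixner_diff:
  assumes c: "0 < c" "c < 1" and eta: "eta = 1 + lam * (1 - 1 / c)\<^sup>2" and "m < n"
  shows "sobolev c lam (\<Sum>j\<le>n. smult (q_seq c eta j) (meixner_diff c j)) (meixner_diff c m) = 0"
proof -
  let ?h = "\<lambda>j. q_seq c eta j * sobolev c lam (meixner_diff c j) (meixner_diff c m)"
  have "sobolev c lam (\<Sum>j\<le>n. smult (q_seq c eta j) (meixner_diff c j)) (meixner_diff c m) = (\<Sum>j\<le>n. ?h j)"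
    by (simp add: sobolev_sum_left[OF c] sobolev_smult_left[OF c])
  \<comment> \<open>Truncated subtraction makes the range \<open>{0, 1}\<close> for
    \<open>m = 0\<close>, where \<open>q\<^sub>0 = q\<^sub>1\<close> gives the cancellation; for
    larger \<open>m\<close> it is the recurrence.\<close>
  also have "\<dots> = (\<Sum>j\<in>{m - 1..Suc m}. ?h j)"
    using \<open>m < n\<close> by (intro sum.mono_neutral_right) (auto simp: sobolev_meixner_diff[OF c eta])
  also have "\<dots> = 0"
  proof (cases m)
    case 0
    then show ?thesis
      by (simp add: sobolev_meixner_diff[OF c eta] numeral_2_eq_2 del: meixner_diff_0)
  next
    case (Suc k)
    then have "{m - 1..Suc m} = {k, Suc k, Suc (Suc k)}" by auto
    then show ?thesis
      using c Suc by (simp add: sobolev_meixner_diff[OF c eta] field_simps)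
  qed
  finally show ?thesis .
qed

text \<open>The leading terms agree, so the difference \<open>D\<close> of the two sides has degree
  below \<open>n\<close>. Both sides are orthogonal to \<open>D\<close>, hence \<open>D\<close> is
  orthogonal to itself.\<close>

lemma sobolev_orthogonal_eq:
  assumes c: "0 < c" "c < 1" and lam: "lam > 0" and eta: "eta = 1 + lam * (1 - 1 / c)\<^sup>2"
    and S_degree: "\<And>n. degree (S n) = n"
    and S_orthogonal: "\<And>n m. n \<noteq> m \<Longrightarrow> sobolev c lam (S n) (S m) = 0"
    and S_lead_coeff: "\<And>n. lead_coeff (S n) = lead_coeff (meixner 1 c n)"
  shows "smult (q_seq c eta n) (S n) = (\<Sum>j\<le>n. smult (q_seq c eta j) (meixner_diff c j))"
proof -
  let ?U = "\<Sum>j\<le>n. smult (q_seq c eta j) (meixner_diff c j)"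
  define D where "D = smult (q_seq c eta n) (S n) - ?U"
  have coeffD: "coeff D k = 0" if "k \<ge> n" for k
  proof -
    have "coeff ?U k = (\<Sum>j\<in>{n}. coeff (smult (q_seq c eta j) (meixner_diff c j)) k)"
      unfolding coeff_sum using that
      by (intro sum.mono_neutral_right) (auto simp: coeff_eq_0 degree_meixner_diff[OF c])
    then show ?thesis
      using that S_lead_coeff[of n] degree_meixner_diff[OF c, of n]
      by (cases "k = n") (auto simp: D_def S_degree coeff_eq_0)
  qed
  have D: "D = 0 \<or> degree D < n"
    using coeffD[of "degree D"] leading_coeff_0_iff[of D] by (meson not_le)
  have S0: "S 0 \<noteq> 0"
    using S_lead_coeff[of 0] by auto
  \<comment> \<open>\<open>D\<close> is expanded in the \<open>S m\<close> here, and in the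
    \<open>meixner_diff c m\<close> for \<open>?U\<close>: in each case the basis for which
    orthogonality is known.\<close>
  have SD: "sobolev c lam (S n) D = 0"
    by (rule linear_functional_vanishes[where B = S and n = n])
      (use S_degree S0 D in \<open>auto simp: sobolev_add_right[OF c] sobolev_smult_right[OF c] S_orthogonal\<close>)
  have UD: "sobolev c lam ?U D = 0"
    by (rule linear_functional_vanishes[where B = "meixner_diff c" and n = n])
      (use D in \<open>auto simp: sobolev_add_right[OF c] sobolev_smult_right[OF c] degree_meixner_diff[OF c]
        sobolev_q_sum_meixner_diff[OF c eta]\<close>)
  have "smult (q_seq c eta n) (S n) = D + ?U"
    by (simp add: D_def)
  then have "sobolev c lam D D = 0"
    using SD UD sobolev_smult_left[OF c, of lam "q_seq c eta n" "S n" D] sobolev_add_left[OF c, of lam D ?U D]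
    by simp
  then have "D = 0"
    by (rule sobolev_self_eq_0_imp[OF c lam])
  then show ?thesis by (simp add: D_def)
qed

section \<open>The generating function of the differences\<close>

text \<open>Both logarithms have imaginary part within pi/2 of 0, so their difference stays on the
  principal branch.\<close>

lemma powr_divide_of_Re_pos:
  fixes u v x :: complex
  assumes "Re u > 0" "Re v > 0"
  shows "(u / v) powr x = u powr x * v powr (- x)"
proof -
  have nz: "u \<noteq> 0" "v \<noteq> 0" using assms by auto
  have "v \<notin> \<real>\<^sub>\<le>\<^sub>0"
    using assms by (auto simp: complex_nonpos_Reals_iff)
  then have "Ln (u * inverse v) = Ln u - Ln v"
    using nz assms Re_Ln_pos_lt[of u] Re_Ln_pos_lt[of v]
    by (subst Ln_times_simple) (auto simp: Ln_inverse abs_less_iff)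
  then show ?thesis
    using nz by (simp add: powr_def divide_inverse right_diff_distrib exp_diff exp_minus)
qed

text \<open>
  Exchanging the order of summation turns the series into the binomial series of \<open>(1 + w)\<^sup>x\<close> with
  \<open>w = t z / (1 - z)\<close>; absolute convergence holds because \<open>(1 / c - 1) |z| / (1 - |z|) < 1\<close> for \<open>|z| < c\<close>.
\<close>

lemma meixner_diff_generating_function:
  fixes x z :: complex
  assumes c: "0 < c" "c < 1" and z: "norm z < c"
  defines "f \<equiv> (\<lambda>n. poly (map_poly of_real (meixner_diff c n)) x * z ^ n)"
  shows "f sums ((1 - z / of_real c) powr x * (1 - z) powr (- x))" and "summable (\<lambda>n. norm (f n))"
proof -
  define t :: complex where "t = of_real (1 - 1 / c)"
  define w where "w = t * z / (1 - z)"
  define r where "r = norm z"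
  have r: "0 \<le> r" "r < c" "r < 1" using z c by (auto simp: r_def)
  have z1: "z \<noteq> 1" using z c by auto
  \<comment> \<open>\<open>?F\<close> lists the terms of \<open>f (Suc n)\<close>; the extra factor
    \<open>z\<close> accounts for the shifted exponent.\<close>
  let ?g = "\<lambda>k. (x gchoose Suc k) * t ^ Suc k * z"
  let ?F = "\<lambda>(k, n). ?g k * (of_nat (n choose k) * z ^ n)"
  \<comment> \<open>Summing the norms over \<open>n\<close> first produces a binomial series in
    \<open>s\<close>, which also bounds \<open>norm w\<close>.\<close>
  define s where "s = norm t * r / (1 - r)"
  have norm_t: "norm t = 1 / c - 1"
    unfolding t_def using c by (simp add: field_simps del: of_real_diff of_real_divide)
  have s: "0 \<le> s" "s < 1"
    using r c mult_left_le_one_le[of r c] unfolding norm_t s_def by (simp_all add: field_simps)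
  have norm_w: "norm w \<le> s"
    unfolding w_def norm_divide norm_mult r_def[symmetric] s_def
    using r norm_triangle_ineq2[of 1 z] z1
    by (intro divide_left_mono mult_pos_pos mult_nonneg_nonneg) (simp_all add: r_def)
  have binom: "summable (\<lambda>k. norm ((x gchoose Suc k) * y ^ Suc k))" if "norm y < 1" for y
  proof -
    obtain K where K: "norm y < K" "K < 1" using dense[OF \<open>norm y < 1\<close>] by blast
    then have "0 < K" using norm_ge_zero[of y] by linarith
    with K have "summable (\<lambda>k. norm ((x gchoose k) * y ^ k))"
      using gen_binomial_complex[of "of_real K" x]
      by (intro powser_insidea[of _ "of_real K"]) (auto simp: sums_iff)
    then show ?thesis by (subst summable_Suc_iff)
  qed
  have "(\<lambda>p. norm (?F p)) summable_on UNIV \<times> UNIV"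
  proof (rule summable_on_SigmaI[where g = "\<lambda>k. norm ((x gchoose Suc k) * of_real s ^ Suc k)"])
    fix k :: nat
    have "(\<lambda>n. real (n choose k) * r ^ n) sums (r ^ k / (1 - r) ^ Suc k)"
         "summable (\<lambda>n. norm (real (n choose k) * r ^ n))"
      using binomial_series[of r k] r by auto
    from sums_mult[OF this(1), of "norm (?g k)"] summable_mult[OF this(2), of "norm (?g k)"]
    have "((\<lambda>n. norm (?F (k, n))) has_sum (norm (?g k) * (r ^ k / (1 - r) ^ Suc k))) UNIV"
      using r by (intro norm_summable_imp_has_sum) (simp_all add: norm_mult norm_power r_def abs_mult mult_ac)
    also have "norm (?g k) * (r ^ k / (1 - r) ^ Suc k) = norm ((x gchoose Suc k) * of_real s ^ Suc k)"
    proof -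
      have "norm ((x gchoose Suc k) * of_real s ^ Suc k) = norm (x gchoose Suc k) * s ^ Suc k"
        using s(1) by (simp only: norm_mult norm_power norm_of_real abs_of_nonneg)
      then show ?thesis
        by (simp add: norm_mult norm_power s_def power_mult_distrib power_divide flip: r_def)
    qed
    finally show "((\<lambda>n. norm (?F (k, n))) has_sum norm ((x gchoose Suc k) * of_real s ^ Suc k)) UNIV" .
  next
    show "(\<lambda>k. norm ((x gchoose Suc k) * of_real s ^ Suc k)) summable_on UNIV"
      using binom[of "of_real s"] s by (intro norm_summable_imp_summable_on) simp_all
  qed auto
  then have F: "?F summable_on UNIV \<times> UNIV"
    by (rule abs_summable_summable)
  \<comment> \<open>Summation over \<open>n\<close> first gives the binomial series without its
    constant term.\<close>
  have "(?F has_sum ((1 + w) powr x - 1)) (UNIV \<times> UNIV)"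
  proof (rule has_sum_SigmaI[OF _ _ F])
    fix k :: nat
    have "(\<lambda>n. of_nat (n choose k) * z ^ n) sums (z ^ k / (1 - z) ^ Suc k)"
         "summable (\<lambda>n. norm (of_nat (n choose k) * z ^ n))"
      using binomial_series[of z k] z c by auto
    from sums_mult[OF this(1), of "?g k"] summable_mult[OF this(2), of "norm (?g k)"]
    have "((\<lambda>n. ?F (k, n)) has_sum (?g k * (z ^ k / (1 - z) ^ Suc k))) UNIV"
      by (intro norm_summable_imp_has_sum) (simp_all add: norm_mult mult_ac)
    also have "?g k * (z ^ k / (1 - z) ^ Suc k) = (x gchoose Suc k) * w ^ Suc k"
      by (simp add: w_def power_mult_distrib power_divide)
    finally show "((\<lambda>n. ?F (k, n)) has_sum ((x gchoose Suc k) * w ^ Suc k)) UNIV" .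
  next
    have "norm w < 1" using norm_w s by linarith
    then have "(\<lambda>k. (x gchoose Suc k) * w ^ Suc k) sums ((1 + w) powr x - 1)"
      using gen_binomial_complex[of w x] by (subst sums_Suc_iff) simp
    then show "((\<lambda>k. (x gchoose Suc k) * w ^ Suc k) has_sum ((1 + w) powr x - 1)) UNIV"
      using binom[OF \<open>norm w < 1\<close>] by (intro norm_summable_imp_has_sum)
  qed
  then have "((\<lambda>(n, k). ?F (k, n)) has_sum ((1 + w) powr x - 1)) (UNIV \<times> UNIV)"
    by (subst (asm) has_sum_swap)
  \<comment> \<open>Summation over \<open>k\<close> first: only \<open>k \<le> n\<close>
    contributes, and \<open>f 0 = 1\<close> later restores the constant term.\<close>
  then have "((\<lambda>n. f (Suc n)) has_sum ((1 + w) powr x - 1)) UNIV"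
  proof (rule has_sum_SigmaD)
    fix n
    have "f (Suc n) = (\<Sum>k\<le>n. ?F (k, n))"
      by (simp add: f_def poly_meixner_diff_Suc sum_distrib_left t_def mult_ac)
    moreover have "((\<lambda>k. ?F (k, n)) has_sum (\<Sum>k\<le>n. ?F (k, n))) UNIV"
      by (rule has_sum_finite_neutralI) auto
    ultimately show "((\<lambda>k. case (n, k) of (n, k) \<Rightarrow> ?F (k, n)) has_sum f (Suc n)) UNIV"
      by simp
  qed
  note f_Suc = this
  have "f 0 = 1"
    by (simp add: f_def one_pCons map_poly_pCons)
  moreover from has_sum_imp_sums[OF f_Suc] have "f sums ((1 + w) powr x - 1 + f 0)"
    by (subst (asm) sums_Suc_iff) simp
  moreover have "1 + w = (1 - z / of_real c) / (1 - z)"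
    using z1 c by (simp add: w_def t_def field_simps)
  moreover have "Re (1 - z / of_real c) > 0" "Re (1 - z) > 0"
    using complex_Re_le_cmod[of z] z c by (simp_all add: Re_divide_of_real)
  ultimately show "f sums ((1 - z / of_real c) powr x * (1 - z) powr (- x))"
    using powr_divide_of_Re_pos[of "1 - z / of_real c" "1 - z" x] by simp
  have "(\<lambda>n. norm (f (Suc n))) summable_on UNIV"
    using has_sum_imp_summable[OF f_Suc] unfolding summable_on_iff_abs_summable_on_complex .
  then show "summable (\<lambda>n. norm (f n))"
    by (rule summable_on_imp_summable[THEN summable_Suc_iff[THEN iffD1]])
qed

section \<open>Closed form of \<open>q_seq\<close> and summation of the series\<close>

text \<open>The quadratic makes \<open>1 / a\<close> and \<open>c * a\<close> the roots of the
  characteristic equation \<open>y\<^sup>2 = (1 + eta * c) * y - c\<close>, distinct because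
  \<open>a\<^sup>2 * c \<noteq> 1\<close>; the weights fit
  \<open>q\<^sub>0 = q\<^sub>1 = 1\<close>.\<close>

lemma q_seq_closed_form:
  assumes "a \<noteq> 0" "a\<^sup>2 * c \<noteq> 1" "c * a\<^sup>2 - (1 + eta * c) * a + 1 = 0"
  shows "q_seq c eta n =
    (a - a\<^sup>2 * c) / (1 - a\<^sup>2 * c) * (1 / a) ^ n + (1 - a) / (1 - a\<^sup>2 * c) * (c * a) ^ n"
proof -
  have rec: "(1 + eta * c) * y ^ Suc n - c * y ^ n = y ^ Suc (Suc n)" if "y\<^sup>2 = (1 + eta * c) * y - c" for y n
  proof -
    have "y ^ Suc (Suc n) = y\<^sup>2 * y ^ n" by (simp add: power2_eq_square)
    then show ?thesis by (simp add: that algebra_simps)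
  qed
  have r1: "(1 / a)\<^sup>2 = (1 + eta * c) * (1 / a) - c"
    using assms by (simp add: field_simps power2_eq_square)
  have "(c * a)\<^sup>2 = c * (c * a\<^sup>2)" by (simp add: power2_eq_square)
  also have "c * a\<^sup>2 = (1 + eta * c) * a - 1" using assms by simp
  finally have r2: "(c * a)\<^sup>2 = (1 + eta * c) * (c * a) - c" by (simp add: algebra_simps)
  show ?thesis
  proof (induction n rule: induct_nat_012)
    case 0
    then show ?case using assms by (simp add: divide_simps)
  next
    case 1
    then show ?case using assms by (simp add: divide_simps) (simp add: algebra_simps power2_eq_square)
  next
    case (ge2 n)
    show ?case
      unfolding q_seq.simps ge2 rec[OF r1, symmetric] rec[OF r2, symmetric]
      by (simp only: algebra_simps)
  qed
qed

theorem theorem4p1: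
  fixes c lam eta a \<gamma> \<delta> :: real and S :: "nat \<Rightarrow> real poly" and x \<omega> :: complex
  assumes c: "0 < c" "c < 1"
    and lam: "lam > 0"
    and eta: "eta = 1 + lam * (1 - 1 / c)\<^sup>2"
    and S_degree: "\<And>n. degree (S n) = n"
    and S_orthogonal: "\<And>n m. n \<noteq> m \<Longrightarrow> sobolev_ip c lam (poly (S n)) (poly (S m)) = 0"
    and S_lead_coeff: "\<And>n. lead_coeff (S n) = lead_coeff (meixner 1 c n)"
    and a: "a = (1 + eta * c - sqrt ((1 + eta * c)\<^sup>2 - 4 * c)) / (2 * c)"
    and \<gamma>: "\<gamma> = (a - a\<^sup>2 * c) / (1 - a\<^sup>2 * c)"
    and \<delta>: "\<delta> = (1 - a) / (1 - a\<^sup>2 * c)"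
    and \<omega>: "norm \<omega> < a * c" "a * c < 1"
  shows "(\<lambda>n. complex_of_real (q_seq c eta n) * poly (map_poly complex_of_real (S n)) x * \<omega> ^ n) sums
    (1 / (1 - \<omega>) *
      (complex_of_real \<gamma> * (1 - \<omega> / complex_of_real (a * c)) powr x
          * (1 - \<omega> / complex_of_real a) powr (- x)
        + complex_of_real \<delta> * (1 - \<omega> * complex_of_real a) powr x
          * (1 - \<omega> * complex_of_real (c * a)) powr (- x)))"
proof -
  define s where "s = 1 + eta * c"
  define D where "D = s\<^sup>2 - 4 * c"
  have "eta \<ge> 1" using lam by (simp add: eta)
  then have "s \<ge> 1 + c" using c by (simp add: s_def)
  have "(1 + c)\<^sup>2 \<le> s\<^sup>2"
    using \<open>s \<ge> 1 + c\<close> c by (intro power_mono) auto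
  moreover have "(1 + c)\<^sup>2 - 4 * c = (1 - c)\<^sup>2"
    by (simp add: power2_eq_square algebra_simps)
  moreover have "0 < (1 - c)\<^sup>2"
    using c by simp
  ultimately have D: "D > 0" unfolding D_def by linarith
  have sqrtD: "s - 2 * c * a = sqrt D"
    using c unfolding a D_def s_def by simp
  then have "(s - 2 * c * a)\<^sup>2 = s\<^sup>2 - 4 * c" using D by (simp add: D_def)
  then have "4 * c * (c * a\<^sup>2 - s * a + 1) = 0"
    by (simp add: power2_eq_square algebra_simps)
  then have quad: "c * a\<^sup>2 - s * a + 1 = 0" using c by simp
  have a_pos: "a > 0"
    using \<omega>(1) c norm_ge_zero[of \<omega>] by (smt (verit) zero_less_mult_pos2)
  \<comment> \<open>As \<open>a\<close> is the smaller root, \<open>s - 2 * c * a\<close> is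
    positive; by \<open>quad\<close> this product equals \<open>1 - a\<^sup>2 * c\<close>.\<close>
  have "0 < a * (s - 2 * c * a)"
    using a_pos D sqrtD by simp
  with quad have ac: "a\<^sup>2 * c < 1" by (simp add: power2_eq_square algebra_simps)
  have q: "q_seq c eta n = \<gamma> * (1 / a) ^ n + \<delta> * (c * a) ^ n" for n
    unfolding \<gamma> \<delta> using quad a_pos ac by (intro q_seq_closed_form) (auto simp: s_def)
  let ?P = "\<lambda>z n. poly (map_poly complex_of_real (meixner_diff c n)) x * z ^ n"
  define f where "f n = of_real (q_seq c eta n) * ?P \<omega> n" for n
  \<comment> \<open>The two geometric parts of \<open>q_seq\<close> move the argument of the
    generating function to \<open>u\<close> and \<open>v\<close>. The bound on \<open>u\<close> is
    the hypothesis on \<open>\<omega>\<close>; that on \<open>v\<close> also uses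
    \<open>a\<^sup>2 * c < 1\<close>.\<close>
  define u v where "u = \<omega> / of_real a" and "v = \<omega> * of_real (c * a)"
  have f: "f = (\<lambda>n. of_real \<gamma> * ?P u n + of_real \<delta> * ?P v n)"
    by (rule ext) (simp add: f_def q u_def v_def power_mult_distrib power_divide algebra_simps)
  have u: "norm u < c"
    using \<omega> a_pos by (simp add: u_def norm_divide field_simps)
  have "norm \<omega> * a < a * c * a"
    using \<omega> a_pos by (intro mult_strict_right_mono)
  then have "norm \<omega> * a < 1"
    using ac by (simp add: power2_eq_square mult_ac)
  then have v: "norm v < c"
    using c a_pos by (simp add: v_def norm_mult mult_ac)
  note gfu = meixner_diff_generating_function[OF c u, of x]
  note gfv = meixner_diff_generating_function[OF c v, of x]
  have f_sums: "f sums (of_real \<gamma> * ((1 - u / of_real c) powr x * (1 - u) powr (- x)) +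
      of_real \<delta> * ((1 - v / of_real c) powr x * (1 - v) powr (- x)))"
    unfolding f by (intro sums_add sums_mult gfu gfv)
  have "summable (\<lambda>n. norm (of_real \<gamma> * ?P u n) + norm (of_real \<delta> * ?P v n))"
    unfolding norm_mult[of "of_real _"] by (intro summable_add summable_mult gfu gfv)
  then have f_abs: "summable (\<lambda>n. norm (f n))"
    unfolding f by (rule summable_comparison_test'[of _ 0]) (simp add: norm_triangle_ineq)
  have "norm \<omega> < 1" using \<omega> by linarith
  then have geo: "summable (\<lambda>n. norm (\<omega> ^ n))" "(\<lambda>n. \<omega> ^ n) sums (1 / (1 - \<omega>))"
    using geometric_sums[of \<omega>] by (simp_all add: norm_power)
  \<comment> \<open>The partial sums of the differences become a convolution with the geometric
    series, whence the factor \<open>1 / (1 - \<omega>)\<close>.\<close>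
  have "of_real (q_seq c eta n) * poly (map_poly of_real (S n)) x * \<omega> ^ n = (\<Sum>j\<le>n. f j * \<omega> ^ (n - j))" for n
  proof -
    have "smult (q_seq c eta n) (S n) = (\<Sum>j\<le>n. smult (q_seq c eta j) (meixner_diff c j))"
      by (rule sobolev_orthogonal_eq[OF c lam eta S_degree _ S_lead_coeff])
        (simp add: S_orthogonal flip: sobolev_ip_poly)
    then have "of_real (q_seq c eta n) * poly (map_poly of_real (S n)) x =
        (\<Sum>j\<le>n. of_real (q_seq c eta j) * poly (map_poly complex_of_real (meixner_diff c j)) x)"
      using poly_of_real_smult[of "q_seq c eta n" "S n" x] by (simp add: poly_of_real_sum poly_of_real_smult)
    then show ?thesis
      by (simp add: sum_distrib_right f_def mult.assoc flip: power_add)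
  qed
  moreover have "1 - u / of_real c = 1 - \<omega> / of_real (a * c)" "1 - v / of_real c = 1 - \<omega> * of_real a"
    using c by (simp_all add: u_def v_def)
  ultimately show ?thesis
    using Cauchy_product_sums[OF f_abs geo(1)] sums_unique[OF f_sums] sums_unique[OF geo(2)]
    by (simp add: u_def v_def mult_ac)
qed

end
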